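(* Let $v,w\in S_n$. There are no defining minors for $I_{v,w}$ (which the paper writes as $I_{v,w}=\emptyset$) if and only if $w=n\ \ n-1\ \ n-2\ \cdots\ 1$ in one-line notation, i.e. $w(i)=n-i+1$ for all $1\le i\le n$.
   Context: For $w\in S_n$ and $1\le s,t\le n$, let $\tilde r_{s,t}^{(w)}=\#\{k\mid k\le t,\ w(k)\ge s\}$. For $v\in S_n$, $Z^{(v)}$ is the $n\times n$ matrix whose entry in row $i$ counted from the bottom and column $j$ from the left is: $1$ if $i=n-v(j)+1$; $0$ if $i>n-v(j)+1$; $0$ if $i=n-v(j')+1$ for some $j'<j$; and an indeterminate $z_{ij}$ otherwise. $Z_{st}^{(v)}$ is the southwest (bottom-left) $(n-s+1)\times t$ submatrix of $Z^{(v)}$. The Kazhdan-Lusztig ideal $I_{v,w}$ is the ideal, in the polynomial ring over $\mathbb{C}$ in the indeterminates appearing in $Z^{(v)}$, generated by all minors of size $\tilde r_{s,t}^{(w)}+1$ of $Z_{st}^{(v)}$, $1\le s,t\le n$. The defining minors of $I_{v,w}$ are the square submatrices of size $\tilde r_{s,t}^{(w)}+1$ of $Z_{st}^{(v)}$, for $1\le s,t\le n$; such a minor exists for a given $(s,t)$ only if $\tilde r_{s,t}^{(w)}+1\le\min\{n-s+1,t\}$. *)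

theory Defs
  imports
    "HOL-Library.Poly_Mapping"
    "HOL-Combinatorics.Permutations"
    "Jordan_Normal_Form.DL_Submatrix"
begin

text \<open>Elements of $S_n$ are functions on \<open>nat\<close> with \<open>w permutes {1..n}\<close>.\<close>

definition sw_rank :: "(nat \<Rightarrow> nat) \<Rightarrow> nat \<Rightarrow> nat \<Rightarrow> nat" where
  "sw_rank w s t = card {k \<in> {1..t}. w k \<ge> s}"

text \<open>
  Polynomials over the complex numbers in indeterminates indexed by pairs \<open>(i, j)\<close>:
  finitely supported maps from monomials (finitely supported exponent functions)
  to coefficients.
\<close>

type_synonym zpoly = "((nat \<times> nat) \<Rightarrow>\<^sub>0 nat) \<Rightarrow>\<^sub>0 complex"

definition zvar :: "nat \<Rightarrow> nat \<Rightarrow> zpoly" where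
  "zvar i j = Poly_Mapping.single (Poly_Mapping.single (i, j) 1) 1"

text \<open>The row index \<open>i\<close> counts from the bottom, the column index \<open>j\<close> from the left, both from 1.\<close>

definition Z_entry :: "nat \<Rightarrow> (nat \<Rightarrow> nat) \<Rightarrow> nat \<Rightarrow> nat \<Rightarrow> zpoly" where
  "Z_entry n v i j =
    (if i = n - v j + 1 then 1
     else if i > n - v j + 1 then 0
     else if \<exists>j'\<in>{1..<j}. i = n - v j' + 1 then 0
     else zvar i j)"

text \<open>
  Library matrices are indexed from 0 starting at the top left corner, so the library row
  \<open>a\<close> is row \<open>n - a\<close> counted from the bottom, and the library column \<open>b\<close> is column \<open>b + 1\<close>.
\<close>

definition Z_mat :: "nat \<Rightarrow> (nat \<Rightarrow> nat) \<Rightarrow> zpoly mat" where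
  "Z_mat n v = mat n n (\<lambda>(a, b). Z_entry n v (n - a) (b + 1))"

text \<open>The bottom \<open>n - s + 1\<close> rows have the library indices \<open>s - 1, \<dots>, n - 1\<close>.\<close>

definition Z_sw :: "nat \<Rightarrow> (nat \<Rightarrow> nat) \<Rightarrow> nat \<Rightarrow> nat \<Rightarrow> zpoly mat" where
  "Z_sw n v s t = submatrix (Z_mat n v) {s - 1..<n} {0..<t}"

text \<open>
  The square submatrices whose determinants generate the Kazhdan-Lusztig ideal. The bounds on
  \<open>I\<close> and \<open>J\<close> are needed because \<open>submatrix\<close> silently ignores indices out of range.
\<close>

definition KL_defining_minors :: "nat \<Rightarrow> (nat \<Rightarrow> nat) \<Rightarrow> (nat \<Rightarrow> nat) \<Rightarrow> zpoly mat set" where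
  "KL_defining_minors n v w =
    {submatrix (Z_sw n v s t) I J | s t I J.
       s \<in> {1..n} \<and> t \<in> {1..n} \<and>
       I \<subseteq> {0..<n - s + 1} \<and> card I = sw_rank w s t + 1 \<and>
       J \<subseteq> {0..<t} \<and> card J = sw_rank w s t + 1}"

end

theory Submission
  imports Defs
begin

text \<open>
  The existence of defining minors is a question of sizes only: a matrix with \<open>p\<close> rows and \<open>t\<close>
  columns has a square submatrix of size \<open>r\<close> iff \<open>r \<le> min p t\<close>. Hence there are no defining minors
  iff every rank \<open>sw_rank w s t\<close> reaches its trivial upper bound \<open>min (n - s + 1) t\<close>
  (lemma \<open>KL_defining_minors_empty_iff\<close>). The reversal \<open>i \<mapsto> n - i + 1\<close> attains all of these
  bounds. Conversely, the bounds on the antidiagonal \<open>s + t = n + 1\<close>, where both terms of the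
  minimum agree, already say that \<open>w i \<ge> n - i + 1\<close> for all \<open>i\<close>, and the only permutation that
  dominates the reversal pointwise is the reversal itself.
\<close>

lemma KL_defining_minors_empty_iff:
  "KL_defining_minors n v w = {} \<longleftrightarrow>
    (\<forall>s\<in>{1..n}. \<forall>t\<in>{1..n}. min (n - s + 1) t \<le> sw_rank w s t)"
proof
  assume empty: "KL_defining_minors n v w = {}"
  show "\<forall>s\<in>{1..n}. \<forall>t\<in>{1..n}. min (n - s + 1) t \<le> sw_rank w s t"
  proof (intro ballI, rule ccontr)
    fix s t
    assume st: "s \<in> {1..n}" "t \<in> {1..n}"
      and small: "\<not> min (n - s + 1) t \<le> sw_rank w s t"
    let ?K = "{0..<sw_rank w s t + 1}"
    have "?K \<subseteq> {0..<n - s + 1}" "?K \<subseteq> {0..<t}" "card ?K = sw_rank w s t + 1"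
      using small by auto
    then have "submatrix (Z_sw n v s t) ?K ?K \<in> KL_defining_minors n v w"
      unfolding KL_defining_minors_def using st by blast
    with empty show False by simp
  qed
next
  assume full: "\<forall>s\<in>{1..n}. \<forall>t\<in>{1..n}. min (n - s + 1) t \<le> sw_rank w s t"
  have False
    if st: "s \<in> {1..n}" "t \<in> {1..n}"
      and I: "I \<subseteq> {0..<n - s + 1}" "card I = sw_rank w s t + 1"
      and J: "J \<subseteq> {0..<t}" "card J = sw_rank w s t + 1" for s t I J
  proof -
    have "card I \<le> n - s + 1" "card J \<le> t"
      using card_mono[OF _ I(1)] card_mono[OF _ J(1)] by simp_all
    with I(2) J(2) full st show False by fastforce
  qed
  then show "KL_defining_minors n v w = {}"
    unfolding KL_defining_minors_def by blast
qed

lemma sw_rank_reversal: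
  assumes rev: "\<forall>i\<in>{1..n}. w i = n - i + 1" and "s \<in> {1..n}" "t \<in> {1..n}"
  shows "sw_rank w s t = min (n - s + 1) t"
proof -
  have "{k \<in> {1..t}. w k \<ge> s} = {1..min (n - s + 1) t}"
    using assms by auto
  then show ?thesis
    unfolding sw_rank_def by simp
qed

lemma sw_rank_full_imp_ge:
  assumes "t \<le> sw_rank w s t" and "k \<in> {1..t}"
  shows "s \<le> w k"
proof -
  have "{k \<in> {1..t}. w k \<ge> s} = {1..t}"
    using assms(1) unfolding sw_rank_def by (intro card_seteq) auto
  with assms(2) show ?thesis by blast
qed

text \<open>
  The values \<open>n, n - 1, \<dots>\<close> are forced one after the other: once the first \<open>i - 1\<close> of them are
  taken, the only value \<open>\<ge> n - i + 1\<close> left for \<open>w i\<close> is \<open>n - i + 1\<close> itself.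
\<close>

lemma permutes_ge_reversal_imp_eq:
  fixes n :: nat
  assumes perm: "w permutes {1..n}" and ge: "\<And>i. i \<in> {1..n} \<Longrightarrow> n - i + 1 \<le> w i"
    and "i \<in> {1..n}"
  shows "w i = n - i + 1"
  using assms(3)
proof (induction i rule: less_induct)
  case (less i)
  have le: "w i \<le> n"
    using permutes_in_image[OF perm, of i] less.prems by simp
  show ?case
  proof (rule ccontr)
    assume "w i \<noteq> n - i + 1"
    with ge[OF less.prems] have gt: "n - i + 1 < w i" by simp
    \<comment> \<open>the position where the reversal takes the value \<open>w i\<close>\<close>
    define k where "k = n - w i + 1"
    have k: "k < i" "k \<in> {1..n}" "n - k + 1 = w i"
      using gt le less.prems unfolding k_def by auto
    then have "w k = w i"
      using less.IH by simp
    then have "k = i"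
      using permutes_inj[OF perm] by (simp add: inj_eq)
    with k(1) show False by simp
  qed
qed

theorem lemma3p1p1:
  fixes n :: nat and v w :: "nat \<Rightarrow> nat"
  assumes "v permutes {1..n}" and "w permutes {1..n}"
  shows "KL_defining_minors n v w = {} \<longleftrightarrow> (\<forall>i\<in>{1..n}. w i = n - i + 1)"
proof
  assume "KL_defining_minors n v w = {}"
  then have full: "\<forall>s\<in>{1..n}. \<forall>t\<in>{1..n}. min (n - s + 1) t \<le> sw_rank w s t"
    by (simp only: KL_defining_minors_empty_iff)
  have "n - i + 1 \<le> w i" if i: "i \<in> {1..n}" for i
  proof -
    have "n - i + 1 \<in> {1..n}" "min (n - (n - i + 1) + 1) i = i"
      using i by auto
    with full i have "i \<le> sw_rank w (n - i + 1) i" by metis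
    then show ?thesis
      by (rule sw_rank_full_imp_ge) (use i in auto)
  qed
  then show "\<forall>i\<in>{1..n}. w i = n - i + 1"
    using permutes_ge_reversal_imp_eq[OF assms(2)] by blast
next
  assume "\<forall>i\<in>{1..n}. w i = n - i + 1"
  then show "KL_defining_minors n v w = {}"
    by (simp add: KL_defining_minors_empty_iff sw_rank_reversal)
qed

end
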